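(* Let $k\ge 1$ and use the convention $A_k(j)=0$ for negative integers $j$. Then for every integer $n\ge 0$, $$A_k(2n+1)=\sum_{i\ge0}\left(\binom{k}{4i+2}+\binom{k}{4i}\right)A_k(n-i)=\left(\binom{k}{2}+\binom{k}{0}\right)A_k(n)+\left(\binom{k}{6}+\binom{k}{4}\right)A_k(n-1)+\cdots,$$ $$A_k(2n+2)=\binom{k}{0}A_k(n+1)+\sum_{i\ge0}\left(\binom{k}{4i+2}+\binom{k}{4i+4}\right)A_k(n-i)=\binom{k}{0}A_k(n+1)+\left(\binom{k}{2}+\binom{k}{4}\right)A_k(n)+\left(\binom{k}{6}+\binom{k}{8}\right)A_k(n-1)+\cdots.$$
   Context: A P-position of the game of Nim with $k$ piles is a $k$-tuple $(p_1,\dots,p_k)$ of non-negative integers whose nim-sum $p_1\oplus\cdots\oplus p_k$ is $0$, where $\oplus$ denotes bitwise XOR. $A_k(n)$ denotes the number of P-positions with $k$ piles whose total number of counters is at most $2n$. Binomial coefficients $\binom{k}{m}$ with $m>k$ are $0$. *)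

theory Defs
  imports Complex_Main
begin

unbundle bit_operations_syntax

definition nim_sum :: "nat list \<Rightarrow> nat" where
  "nim_sum ps = foldr (XOR) ps 0"

definition P_positions :: "nat \<Rightarrow> nat list set" where
  "P_positions k = {ps. length ps = k \<and> nim_sum ps = 0}"

text \<open>The argument \<open>n\<close> is an integer so that the convention of the value \<open>0\<close> at negative
  arguments can be stated. The set whose cardinality is taken is always finite, so \<open>card\<close> is not
  used at its default value (lemma \<open>finite_bounded_P_positions\<close>).\<close>

definition A :: "nat \<Rightarrow> int \<Rightarrow> nat" where
  "A k n = (if n < 0 then 0 else card {ps \<in> P_positions k. sum_list ps \<le> 2 * nat n})"

lemma finite_bounded_P_positions: "finite {ps \<in> P_positions k. sum_list ps \<le> m}"
proof (rule finite_subset)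
  show "{ps \<in> P_positions k. sum_list ps \<le> m} \<subseteq> {ps. set ps \<subseteq> {..m} \<and> length ps = k}"
    using member_le_sum_list by (fastforce simp: P_positions_def)
  show "finite {ps. set ps \<subseteq> {..m} \<and> length ps = k}"
    by (rule finite_lists_length_eq) simp
qed

end

theory Submission
  imports Defs
begin

text \<open>Splitting off the last binary digit of every pile maps a P-position \<open>ps\<close> to the pair of the
  halved position, again a P-position, and the set \<open>S\<close> of odd piles, whose cardinality is an
  arbitrary even number \<open>2 * j\<close>. As P-positions have an even number of counters, this gives
  \<open>A k m = (\<Sum>j. (k choose (2 * j)) * A k ((m - j) div 2))\<close>; the theorem collects the equal values of
  \<open>(m - j) div 2\<close> in pairs.\<close>

lemma nim_sum_div_2: "nim_sum ps div 2 = nim_sum (map (\<lambda>p. p div 2) ps)"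
proof -
  have "(a XOR b) div 2 = (a div 2) XOR (b div 2)" for a b :: nat
    using drop_bit_xor [of 1 a b] by (simp only: drop_bit_eq_div power_one_right)
  then show ?thesis
    by (induction ps) (simp_all add: nim_sum_def)
qed

lemma odd_nim_sum_iff: "odd (nim_sum ps) \<longleftrightarrow> odd (sum_list ps)"
  by (induction ps) (simp_all add: nim_sum_def even_xor_iff)

text \<open>A number vanishes iff both its half and its last binary digit do. Halving commutes with
  XOR, and the last digit of the nim-sum is the parity of the total.\<close>

lemma P_positions_iff_halves:
  "ps \<in> P_positions k \<longleftrightarrow> map (\<lambda>p. p div 2) ps \<in> P_positions k \<and> even (sum_list ps)"
proof -
  have "nim_sum ps = 0 \<longleftrightarrow> nim_sum ps div 2 = 0 \<and> even (nim_sum ps)"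
    by presburger
  then show ?thesis
    using odd_nim_sum_iff [of ps] by (auto simp: P_positions_def nim_sum_div_2)
qed

definition odd_piles :: "nat list \<Rightarrow> nat set" where
  "odd_piles ps = {i. i < length ps \<and> odd (ps ! i)}"

text \<open>The remainders modulo 2 add up to the number of odd piles. Hence an even total forces an
  even number of odd piles, and conversely.\<close>

lemma sum_list_halves:
  "sum_list ps = 2 * sum_list (map (\<lambda>p. p div 2) ps) + card (odd_piles ps)"
proof -
  let ?I = "{0..<length ps}"
  have "card (odd_piles ps) = (\<Sum>i\<in>?I. if odd (ps ! i) then 1 else 0)"
    by (simp add: odd_piles_def sum.If_cases Int_def)
  also have "\<dots> = (\<Sum>i\<in>?I. ps ! i mod 2)"
    by (intro sum.cong) (auto simp: odd_iff_mod_2_eq_one)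
  finally show ?thesis
    by (simp add: sum_list_sum_nth sum_distrib_left flip: sum.distrib)
qed

text \<open>With \<open>r = 2 * j\<close>, the bound says that \<open>sum_list qs\<close> is at most
  \<open>m - j\<close>. The total of a P-position is even, so this bound may be rounded down to an
  even number.\<close>

lemma card_bounded_P_positions:
  assumes "even r"
  shows "card {qs \<in> P_positions k. 2 * sum_list qs + r \<le> 2 * m} =
    A k ((int m - int (r div 2)) div 2)"
proof -
  obtain j where j: "r = 2 * j"
    using assms by blast
  show ?thesis
  proof (cases "j \<le> m")
    case True
    have "2 * sum_list qs + r \<le> 2 * m \<longleftrightarrow> sum_list qs \<le> 2 * ((m - j) div 2)"
      if "qs \<in> P_positions k" for qs
    proof -
      have "even (sum_list qs)"
        using that P_positions_iff_halves by blast
      with True j show ?thesis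
        by presburger
    qed
    then have "{qs \<in> P_positions k. 2 * sum_list qs + r \<le> 2 * m} =
        {qs \<in> P_positions k. sum_list qs \<le> 2 * ((m - j) div 2)}"
      by blast
    moreover have "(int m - int (r div 2)) div 2 = int ((m - j) div 2)"
      using True j by (simp add: zdiv_int of_nat_diff)
    ultimately show ?thesis
      by (simp add: A_def)
  next
    \<comment> \<open>The integer \<open>div\<close> rounds downwards, so the argument of
      \<open>A\<close> stays negative even for \<open>m - j = -1\<close>; the convention for
      \<open>A\<close> then matches the empty set.\<close>
    case False
    then have "{qs \<in> P_positions k. 2 * sum_list qs + r \<le> 2 * m} = {}"
      using j by auto
    moreover have "(int m - int (r div 2)) div 2 < 0"
      using False j by simp
    ultimately show ?thesis
      by (simp only: A_def if_True card.empty)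
  qed
qed

lemma bij_betw_halves_odd_piles:
  "bij_betw (\<lambda>ps. (odd_piles ps, map (\<lambda>p. p div 2) ps))
    {ps \<in> P_positions k. sum_list ps \<le> 2 * m}
    (SIGMA S:{S. S \<subseteq> {..<k} \<and> even (card S)}.
      {qs \<in> P_positions k. 2 * sum_list qs + card S \<le> 2 * m})"
  (is "bij_betw ?f ?B ?C")
proof (rule bij_betwI')
  fix ps ps' assume "ps \<in> ?B" "ps' \<in> ?B"
  then have len: "length ps = k" "length ps' = k"
    by (auto simp: P_positions_def)
  show "?f ps = ?f ps' \<longleftrightarrow> ps = ps'"
  proof
    assume eq: "?f ps = ?f ps'"
    show "ps = ps'"
    proof (rule nth_equalityI)
      fix i assume i: "i < length ps"
      have "ps ! i div 2 = ps' ! i div 2"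
        using arg_cong [of _ _ "\<lambda>qs. qs ! i", OF conjunct2 [OF eq [unfolded prod.inject]]] i len
        by simp
      moreover have "odd (ps ! i) \<longleftrightarrow> odd (ps' ! i)"
        using eq i len by (auto simp: odd_piles_def set_eq_iff)
      ultimately show "ps ! i = ps' ! i"
        by presburger
    qed (use len in simp)
  qed simp
next
  fix ps assume "ps \<in> ?B"
  then show "?f ps \<in> ?C"
    using P_positions_iff_halves [of ps k] sum_list_halves [of ps]
    by (auto simp: odd_piles_def P_positions_def)
next
  fix y assume "y \<in> ?C"
  then obtain S qs where y: "y = (S, qs)" and S: "S \<subseteq> {..<k}" "even (card S)"
    and qs: "qs \<in> P_positions k" "2 * sum_list qs + card S \<le> 2 * m"
    by blast
  then have len: "length qs = k"
    by (simp add: P_positions_def)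
  \<comment> \<open>The inverse map: append the digit 1 to the piles indexed by \<open>S\<close> and
    the digit 0 to all others.\<close>
  define ps where "ps = map (\<lambda>i. 2 * qs ! i + of_bool (i \<in> S)) [0..<k]"
  have odd: "odd_piles ps = S"
    using S by (auto simp: ps_def odd_piles_def)
  have half: "map (\<lambda>p. p div 2) ps = qs"
    using len by (intro nth_equalityI) (auto simp: ps_def)
  have "ps \<in> ?B"
    using S qs sum_list_halves [of ps] P_positions_iff_halves [of ps k]
    unfolding odd half by simp
  then show "\<exists>ps\<in>?B. y = ?f ps"
    using odd half y by blast
qed

text \<open>Group the sets \<open>S\<close> of odd piles by \<open>j = card S div 2\<close>. The
  cutoff \<open>N\<close> is left free so that the range can be fitted to either pairing of the
  indices.\<close>

lemma A_rec:
  assumes "k < N"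
  shows "A k (int m) = (\<Sum>j<N. (k choose (2 * j)) * A k ((int m - int j) div 2))"
proof -
  let ?E = "{S. S \<subseteq> {..<k} \<and> even (card S)}"
  let ?a = "\<lambda>j. A k ((int m - int j) div 2)"
  have fin: "finite ?E"
    by (rule finite_subset [of _ "Pow {..<k}"]) auto
  have fin2: "finite {qs \<in> P_positions k. 2 * sum_list qs + r \<le> 2 * m}" for r
    by (rule finite_subset [OF _ finite_bounded_P_positions [of k m]]) auto
  have "A k (int m) = card {ps \<in> P_positions k. sum_list ps \<le> 2 * m}"
    by (simp add: A_def)
  also have "\<dots> = (\<Sum>S\<in>?E. card {qs \<in> P_positions k. 2 * sum_list qs + card S \<le> 2 * m})"
    using bij_betw_same_card [OF bij_betw_halves_odd_piles] fin fin2 by simp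
  also have "\<dots> = (\<Sum>S\<in>?E. ?a (card S div 2))"
    by (intro sum.cong) (auto simp: card_bounded_P_positions)
  also have "\<dots> = (\<Sum>j<N. \<Sum>S\<in>{S \<in> ?E. card S div 2 = j}. ?a (card S div 2))"
  proof (rule sum.group [symmetric, OF fin])
    have "card S div 2 < N" if "S \<subseteq> {..<k}" for S
      using card_mono [OF _ that] assms by simp
    then show "(\<lambda>S. card S div 2) ` ?E \<subseteq> {..<N}"
      by blast
  qed simp
  also have "\<dots> = (\<Sum>j<N. (k choose (2 * j)) * ?a j)"
  proof (intro sum.cong refl)
    fix j
    have "{S \<in> ?E. card S div 2 = j} = {S. S \<subseteq> {..<k} \<and> card S = 2 * j}"
      by auto
    then show "(\<Sum>S\<in>{S \<in> ?E. card S div 2 = j}. ?a (card S div 2)) = (k choose (2 * j)) * ?a j"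
      by (simp add: n_subsets)
  qed
  finally show ?thesis .
qed

lemma sum_lessThan_double:
  fixes f :: "nat \<Rightarrow> 'a::comm_monoid_add"
  shows "(\<Sum>j<2 * M. f j) = (\<Sum>i<M. f (2 * i) + f (2 * i + 1))"
  by (induction M) (simp_all add: add.assoc)

theorem theorem30:
  fixes k n :: nat
  assumes "k \<ge> 1"
  shows
    "(summable (\<lambda>i. ((k choose (4 * i + 2)) + (k choose (4 * i))) * A k (int n - int i)) \<and>
      A k (2 * int n + 1) =
        (\<Sum>i. ((k choose (4 * i + 2)) + (k choose (4 * i))) * A k (int n - int i))) \<and>
     (summable (\<lambda>i. ((k choose (4 * i + 2)) + (k choose (4 * i + 4))) * A k (int n - int i)) \<and>
      A k (2 * int n + 2) =
        (k choose 0) * A k (int n + 1) +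
        (\<Sum>i. ((k choose (4 * i + 2)) + (k choose (4 * i + 4))) * A k (int n - int i)))"
proof -
  let ?f = "\<lambda>i. ((k choose (4 * i + 2)) + (k choose (4 * i))) * A k (int n - int i)"
  let ?g = "\<lambda>i. ((k choose (4 * i + 2)) + (k choose (4 * i + 4))) * A k (int n - int i)"
  \<comment> \<open>For \<open>2 * n + 1\<close> the equal values occur at \<open>j = 2 * i\<close>
    and \<open>j = 2 * i + 1\<close>. For \<open>2 * n + 2\<close> they occur at
    \<open>j = 2 * i + 1\<close> and \<open>j = 2 * i + 2\<close>, which leaves \<open>j = 0\<close>
    alone.\<close>
  have div: "(2 * int n + 1 - int (2 * i)) div 2 = int n - int i"
    "(2 * int n + 1 - int (2 * i + 1)) div 2 = int n - int i"
    "(2 * int n + 2 - int (Suc (2 * i))) div 2 = int n - int i"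
    "(2 * int n + 2 - int (Suc (2 * i + 1))) div 2 = int n - int i" for i
    by presburger+
  have idx: "2 * Suc (2 * i) = 4 * i + 2" "2 * Suc (2 * i + 1) = 4 * i + 4" for i
    by simp_all
  \<comment> \<open>From \<open>i = Suc k\<close> on, all lower indices of the binomials exceed
    \<open>k\<close>, so both series are finite sums.\<close>
  have f: "?f sums (\<Sum>i<Suc k. ?f i)" and g: "?g sums (\<Sum>i<Suc k. ?g i)"
    by (rule sums_finite; simp)+
  have "A k (2 * int n + 1) = (\<Sum>j<2 * Suc k. (k choose (2 * j)) * A k ((2 * int n + 1 - int j) div 2))"
    using A_rec [of k "2 * Suc k" "2 * n + 1"] by (simp add: algebra_simps)
  also have "\<dots> = (\<Sum>i<Suc k. ?f i)"
    unfolding sum_lessThan_double div by (simp add: algebra_simps)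
  finally have odd: "A k (2 * int n + 1) = (\<Sum>i<Suc k. ?f i)" .
  \<comment> \<open>The odd number of terms allows splitting off \<open>j = 0\<close>, the source of
    the separate summand, before pairing the rest.\<close>
  have "A k (2 * int n + 2) =
      (\<Sum>j<Suc (2 * Suc k). (k choose (2 * j)) * A k ((2 * int n + 2 - int j) div 2))"
    using A_rec [of k "Suc (2 * Suc k)" "2 * n + 2"] by (simp add: algebra_simps)
  also have "\<dots> = (k choose 0) * A k (int n + 1) + (\<Sum>i<Suc k. ?g i)"
    unfolding sum.lessThan_Suc_shift [of _ "2 * Suc k"] sum_lessThan_double div idx
    by (simp add: add_mult_distrib algebra_simps del: add_2_eq_Suc add_2_eq_Suc')
  finally have even: "A k (2 * int n + 2) = (k choose 0) * A k (int n + 1) + (\<Sum>i<Suc k. ?g i)" .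
  show ?thesis
    using odd even sums_summable [OF f] sums_summable [OF g] sums_unique [OF f] sums_unique [OF g]
    by simp
qed

end
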